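(* Let $\mathcal{A}$ be a unital Banach algebra and let $a,b,c,d\in\mathcal{A}$ satisfy $acd=dbd$ and $dba=aca$. Put $\alpha=1-ac$ and $\beta=1-bd$. Then $\alpha$ is left (resp. right) generalized Drazin invertible if and only if $\beta$ is left (resp. right) generalized Drazin invertible. More precisely, if $x$ is a left (resp. right) generalized Drazin inverse of $\alpha$ and $p=1-x\alpha$ (resp. $p=1-\alpha x$), then $$y=\bigl(1-bacp[1-p\alpha(1+ac)]^{-1}d\bigr)(1+bd)+bacxd$$ is a left (resp. right) generalized Drazin inverse of $\beta$. Conversely, if $y$ is a left (resp. right) generalized Drazin inverse of $\beta$ and $p'=1-y\beta$ (resp. $p'=1-\beta y$), then $$x=\bigl(1-dp'[1-p'\beta(1+bd)]^{-1}bac\bigr)(1+ac)+dybac$$ is a left (resp. right) generalized Drazin inverse of $\alpha$. (The inverses appearing in these formulas exist.)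
   Context: $\mathcal{A}$ is a complex unital Banach algebra, $r(\cdot)$ denotes the spectral radius, and $\mathcal{A}^{qnil}=\{a\in\mathcal{A}: r(a)=0\}$. An element $a\in\mathcal{A}$ is left generalized Drazin invertible if there exists $x\in\mathcal{A}$ (a left generalized Drazin inverse of $a$) with $axa=xa^2$, $x^2a=x$, $axa-a\in\mathcal{A}^{qnil}$; it is right generalized Drazin invertible if there exists $y\in\mathcal{A}$ (a right generalized Drazin inverse of $a$) with $aya=a^2y$, $ay^2=y$, $aya-a\in\mathcal{A}^{qnil}$. *)

theory Defs
  imports "HOL-Analysis.Analysis"
begin

class complex_unital_banach_algebra = real_normed_algebra_1 + banach +
  fixes scaleC :: "complex \<Rightarrow> 'a \<Rightarrow> 'a"  (infixr \<open>*\<^sub>C\<close> 75)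
  assumes scaleC_add_right: "z *\<^sub>C (a + b) = z *\<^sub>C a + z *\<^sub>C b"
    and scaleC_add_left: "(z + w) *\<^sub>C a = z *\<^sub>C a + w *\<^sub>C a"
    and scaleC_scaleC: "z *\<^sub>C (w *\<^sub>C a) = (z * w) *\<^sub>C a"
    and scaleC_complex_of_real: "complex_of_real t *\<^sub>C a = t *\<^sub>R a"
    and mult_scaleC_left: "(z *\<^sub>C a) * b = z *\<^sub>C (a * b)"
    and mult_scaleC_right: "a * (z *\<^sub>C b) = z *\<^sub>C (a * b)"
    and norm_scaleC: "norm (z *\<^sub>C a) = cmod z * norm a"

definition two_sided_inverse :: "'a::monoid_mult \<Rightarrow> 'a \<Rightarrow> bool"
  where "two_sided_inverse a b \<longleftrightarrow> a * b = 1 \<and> b * a = 1"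

definition invertible_elem :: "'a::monoid_mult \<Rightarrow> bool"
  where "invertible_elem a \<longleftrightarrow> (\<exists>b. two_sided_inverse a b)"

text \<open>Only meaningful for invertible elements, for which the inverse is unique.\<close>

definition inv_elem :: "'a::monoid_mult \<Rightarrow> 'a"
  where "inv_elem a = (THE b. two_sided_inverse a b)"

definition spectrum :: "'a::complex_unital_banach_algebra \<Rightarrow> complex set"
  where "spectrum a = {z. \<not> invertible_elem (z *\<^sub>C 1 - a)}"

text \<open>The spectrum in a complex unital Banach algebra is nonempty and bounded, so the
  conditionally complete supremum on the reals is the true supremum here.\<close>

definition spectral_radius :: "'a::complex_unital_banach_algebra \<Rightarrow> real"
  where "spectral_radius a = (SUP z\<in>spectrum a. cmod z)"

definition qnil :: "'a::complex_unital_banach_algebra set"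
  where "qnil = {a. spectral_radius a = 0}"

text \<open>The first argument is the element, the second one its generalized Drazin inverse.\<close>

definition left_gDrazin_inverse :: "'a::complex_unital_banach_algebra \<Rightarrow> 'a \<Rightarrow> bool"
  where "left_gDrazin_inverse a x \<longleftrightarrow>
    a * x * a = x * a\<^sup>2 \<and> x\<^sup>2 * a = x \<and> a * x * a - a \<in> qnil"

definition right_gDrazin_inverse :: "'a::complex_unital_banach_algebra \<Rightarrow> 'a \<Rightarrow> bool"
  where "right_gDrazin_inverse a y \<longleftrightarrow>
    a * y * a = a\<^sup>2 * y \<and> a * y\<^sup>2 = y \<and> a * y * a - a \<in> qnil"

definition left_gDrazin_invertible :: "'a::complex_unital_banach_algebra \<Rightarrow> bool"
  where "left_gDrazin_invertible a \<longleftrightarrow> (\<exists>x. left_gDrazin_inverse a x)"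

definition right_gDrazin_invertible :: "'a::complex_unital_banach_algebra \<Rightarrow> bool"
  where "right_gDrazin_invertible a \<longleftrightarrow> (\<exists>y. right_gDrazin_inverse a y)"

end

theory Submission
  imports Defs
begin

text \<open>
  Put \<open>A = a c\<close>, \<open>B = b d\<close> and \<open>e = b a c\<close>. The two hypotheses yield
  \<open>A d = d B\<close>, \<open>B e = e A\<close>, \<open>d e = A\<^sup>2\<close> and \<open>e d = B\<^sup>2\<close>. These four identities are invariant under
  exchanging \<open>(A, d)\<close> with \<open>(B, e)\<close>, and the two formulas of the theorem are exchanged as well;
  hence only the passage from \<open>\<alpha> = 1 - A\<close> to \<open>\<beta> = 1 - B\<close> has to be carried out. Since
  \<open>\<alpha> (1 + A) = 1 - d e\<close> and \<open>\<beta> (1 + B) = 1 - e d\<close>, it is a form of Jacobson's lemma.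

  A left generalized Drazin inverse \<open>x\<close> of \<open>\<alpha>\<close> is best described by \<open>p = 1 - x \<alpha>\<close>: the defining
  equations say that \<open>x p = 0\<close>, that \<open>p\<close> commutes with \<open>\<alpha>\<close>, and that \<open>p \<alpha>\<close> is quasinilpotent
  (\<open>left_gDrazin_inverse_iff\<close>); then \<open>p\<close> is idempotent. On the corner of \<open>p\<close> the element
  \<open>A = 1 - \<alpha>\<close> is therefore invertible, and
  \<open>s = p [1 - p \<alpha> (1 + A)]\<^sup>-\<^sup>1\<close> is the inverse of \<open>A\<^sup>2\<close> there, because
  \<open>p - p \<alpha> (1 + A) = p A\<^sup>2\<close> (\<open>corner_inverse\<close>). Consequently
  \<open>q = e s d\<close> is an idempotent commuting with \<open>B\<close>. Moreover \<open>q \<beta>\<close> is quasinilpotent, because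
  \<open>e (s d \<beta>)\<close> and \<open>(s d \<beta>) e = p \<alpha>\<close> have the same nonzero spectrum
  (\<open>transferred_idempotent\<close>). A short computation with the proposed element
  \<open>y = (1 - q) (1 + B) + e x d\<close> gives \<open>1 - y \<beta> = q\<close> and \<open>y q = 0\<close>, so \<open>y\<close> is a left generalized
  Drazin inverse of \<open>\<beta>\<close>. The right-handed case is the mirror image.

  The analytic input is that \<open>a\<close> is quasinilpotent precisely when \<open>z - a\<close> is invertible for
  every \<open>z \<noteq> 0\<close> (\<open>qnil_iff\<close>). As the spectral radius is a supremum over the spectrum, this
  rests on the boundedness (Neumann series) and nonemptiness of the spectrum. The latter is proved
  by a form of Liouville's theorem: an everywhere defined resolvent would satisfy the mean value
  property on circles about \<open>0\<close> and tend to zero at infinity.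
\<close>

section \<open>Inverses and complex scalars\<close>

lemma two_sided_inverse_unique:
  assumes "two_sided_inverse a x" "two_sided_inverse a y"
  shows "x = y"
  using assms unfolding two_sided_inverse_def by (metis mult.assoc mult_1_left mult_1_right)

lemma inv_elem_inverse:
  assumes "invertible_elem a"
  shows "a * inv_elem a = 1" "inv_elem a * a = 1"
proof -
  obtain x where x: "two_sided_inverse a x"
    using assms unfolding invertible_elem_def by blast
  then have "two_sided_inverse a (inv_elem a)"
    unfolding inv_elem_def by (rule theI) (rule two_sided_inverse_unique[OF _ x])
  then show "a * inv_elem a = 1" "inv_elem a * a = 1"
    unfolding two_sided_inverse_def by auto
qed

lemma invertible_elemI:
  assumes "a * x = 1" "x * a = 1"
  shows "invertible_elem a"
  using assms unfolding invertible_elem_def two_sided_inverse_def by blast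

lemma invertible_elem_mult:
  assumes "invertible_elem a" "invertible_elem b"
  shows "invertible_elem (a * b)"
proof (rule invertible_elemI)
  show "a * b * (inv_elem b * inv_elem a) = 1"
    using inv_elem_inverse[OF assms(1)] inv_elem_inverse[OF assms(2)]
    by (metis mult.assoc mult_1_right)
  show "inv_elem b * inv_elem a * (a * b) = 1"
    using inv_elem_inverse[OF assms(1)] inv_elem_inverse[OF assms(2)]
    by (metis mult.assoc mult_1_right)
qed

lemma inv_elem_commute:
  assumes "invertible_elem h" "u * h = h * u"
  shows "u * inv_elem h = inv_elem h * u"
proof -
  have "u * inv_elem h = inv_elem h * (h * u) * inv_elem h"
    using inv_elem_inverse[OF assms(1)] by (metis mult.assoc mult_1_left)
  also have "\<dots> = inv_elem h * u"
    using inv_elem_inverse[OF assms(1)] assms(2) by (metis mult.assoc mult_1_right)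
  finally show ?thesis .
qed

lemma scaleC_one: "1 *\<^sub>C a = (a::'a::complex_unital_banach_algebra)"
  using scaleC_complex_of_real[of 1 a] by simp

lemma scaleC_zero_left: "0 *\<^sub>C a = (0::'a::complex_unital_banach_algebra)"
  using scaleC_complex_of_real[of 0 a] by simp

lemma scaleC_minus_left: "(- z) *\<^sub>C a = - (z *\<^sub>C (a::'a::complex_unital_banach_algebra))"
  using scaleC_add_left[of "- z" z a] by (simp add: scaleC_zero_left eq_neg_iff_add_eq_0)

lemma bounded_bilinear_scaleC:
  "bounded_bilinear (\<lambda>z a :: 'a::complex_unital_banach_algebra. z *\<^sub>C a)"
proof
  fix r :: real and z w :: complex and a b :: 'a
  show "(z + w) *\<^sub>C a = z *\<^sub>C a + w *\<^sub>C a" by (rule scaleC_add_left)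
  show "z *\<^sub>C (a + b) = z *\<^sub>C a + z *\<^sub>C b" by (rule scaleC_add_right)
  show "(r *\<^sub>R z) *\<^sub>C a = r *\<^sub>R (z *\<^sub>C a)"
    by (simp add: scaleR_conv_of_real scaleC_complex_of_real flip: scaleC_scaleC)
  show "z *\<^sub>C (r *\<^sub>R a) = r *\<^sub>R (z *\<^sub>C a)"
    by (simp add: scaleC_scaleC mult.commute flip: scaleC_complex_of_real)
  show "\<exists>K. \<forall>(z::complex) a::'a. norm (z *\<^sub>C a) \<le> norm z * norm a * K"
    by (rule exI[of _ 1]) (simp add: norm_scaleC)
qed

lemmas bounded_linear_scaleC_left = bounded_bilinear.bounded_linear_left[OF bounded_bilinear_scaleC]
lemmas bounded_linear_scaleC_right = bounded_bilinear.bounded_linear_right[OF bounded_bilinear_scaleC]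

section \<open>Nonemptiness of the spectrum\<close>

lemma invertible_one_minus:
  fixes a :: "'a::{real_normed_algebra_1,banach}"
  assumes "norm a < 1"
  shows "invertible_elem (1 - a)"
proof -
  let ?s = "\<Sum>n. a ^ n"
  have s: "summable (\<lambda>n. a ^ n)" by (rule complete_algebra_summable_geometric[OF assms])
  have "?s = 1 + (\<Sum>n. a ^ Suc n)" using suminf_split_head[OF s] by simp
  moreover have "(\<Sum>n. a ^ Suc n) = a * ?s" using suminf_mult[OF s, of a] by simp
  moreover have "(\<Sum>n. a ^ Suc n) = ?s * a"
    using suminf_mult2[OF s, of a] by (simp add: power_commutes)
  ultimately show ?thesis
    by (intro invertible_elemI[of _ ?s]) (simp_all add: algebra_simps)
qed

lemma spectrum_norm_le:
  assumes "z \<in> spectrum a"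
  shows "cmod z \<le> norm a"
proof (rule ccontr)
  assume "\<not> cmod z \<le> norm a"
  then have z: "norm a < cmod z" "z \<noteq> 0" by auto
  have "norm (inverse z *\<^sub>C a) = norm a / cmod z"
    by (simp add: norm_scaleC norm_inverse divide_inverse)
  then have "norm (inverse z *\<^sub>C a) < 1" using z by (simp add: divide_less_eq)
  then have "invertible_elem (1 - inverse z *\<^sub>C a)" by (rule invertible_one_minus)
  moreover have "invertible_elem (z *\<^sub>C (1::'a))"
    by (rule invertible_elemI[of _ "inverse z *\<^sub>C 1"])
       (use z(2) in \<open>simp_all add: mult_scaleC_left scaleC_scaleC scaleC_one\<close>)
  ultimately have "invertible_elem (z *\<^sub>C 1 * (1 - inverse z *\<^sub>C a))"
    by (rule invertible_elem_mult[rotated])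
  moreover have "z *\<^sub>C 1 * (1 - inverse z *\<^sub>C a) = z *\<^sub>C 1 - a"
    using z(2) by (simp add: right_diff_distrib mult_scaleC_left scaleC_scaleC scaleC_one)
  ultimately show False using assms by (simp add: spectrum_def)
qed

text \<open>
  Everything follows from \<open>k t - k0 = k t (h0 - h t) k0\<close>. This identity first bounds \<open>k t\<close> by
  \<open>2 \<parallel>k0\<parallel>\<close> once \<open>h t\<close> is close to \<open>h0\<close>, and then gives convergence.
\<close>

lemma tendsto_two_sided_inverse:
  fixes h :: "'b \<Rightarrow> 'a::real_normed_algebra_1"
  assumes h: "(h \<longlongrightarrow> h0) F"
    and k: "\<And>t. two_sided_inverse (h t) (k t)" and k0: "two_sided_inverse h0 k0"
  shows "(k \<longlongrightarrow> k0) F"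
proof -
  have eq: "k t - k0 = k t * (h0 - h t) * k0" for t
  proof -
    have "k t * (h0 - h t) * k0 = k t * (h0 * k0) - (k t * h t) * k0"
      by (simp add: algebra_simps)
    then show ?thesis using k[of t] k0 by (simp add: two_sided_inverse_def)
  qed
  have lim: "((\<lambda>t. norm (h0 - h t) * norm k0) \<longlongrightarrow> 0) F"
    using tendsto_mult_left_zero[OF tendsto_norm_zero[OF
      tendsto_diff[OF tendsto_const[of h0] h, simplified]], of "norm k0"] by simp
  have le: "norm (k t - k0) \<le> norm (k t) * (norm (h0 - h t) * norm k0)" for t
    unfolding eq mult.assoc
    by (rule order_trans[OF norm_mult_ineq mult_left_mono[OF norm_mult_ineq norm_ge_zero]])
  have ev: "\<forall>\<^sub>F t in F. norm (h0 - h t) * norm k0 < 1 / 2"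
    using order_tendstoD(2)[OF lim, of "1/2"] by simp
  have "\<forall>\<^sub>F t in F. norm (k t - k0) \<le> 2 * norm k0 * (norm (h0 - h t) * norm k0)"
    using ev
  proof eventually_elim
    case (elim t)
    have "norm (k t) \<le> norm k0 + norm (k t - k0)" by norm
    also have "norm (k t - k0) \<le> norm (k t) * (1 / 2)"
      using le[of t] mult_left_mono[OF less_imp_le[OF elim], of "norm (k t)"] by simp
    finally have "norm (k t) \<le> 2 * norm k0" by simp
    then show ?case
      using le[of t] mult_right_mono[of "norm (k t)" "2 * norm k0" "norm (h0 - h t) * norm k0"]
      by simp
  qed
  moreover have "((\<lambda>t. 2 * norm k0 * (norm (h0 - h t) * norm k0)) \<longlongrightarrow> 0) F"
    using tendsto_mult_right_zero[OF lim] by simp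
  ultimately have "((\<lambda>t. k t - k0) \<longlongrightarrow> 0) F"
    by (rule Lim_null_comparison)
  then show ?thesis by (simp add: LIM_zero_iff)
qed

lemma has_vector_derivative_iff_quotient:
  "(f has_vector_derivative f') (at t within S) \<longleftrightarrow>
    ((\<lambda>y. (f y - f t) /\<^sub>R (y - t)) \<longlongrightarrow> f') (at t within S)"
proof -
  have "norm (f y - f t - (y - t) *\<^sub>R f') / norm (y - t) = norm ((f y - f t) /\<^sub>R (y - t) - f')"
    if "y \<noteq> t" for y
  proof -
    have "f y - f t - (y - t) *\<^sub>R f' = (y - t) *\<^sub>R ((f y - f t) /\<^sub>R (y - t) - f')"
      using that by (simp add: scaleR_diff_right)
    then show ?thesis using that by simp
  qed
  then have "((\<lambda>y. norm (f y - f t - (y - t) *\<^sub>R f') / norm (y - t)) \<longlongrightarrow> 0) (at t within S)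
    \<longleftrightarrow> ((\<lambda>y. norm ((f y - f t) /\<^sub>R (y - t) - f')) \<longlongrightarrow> 0) (at t within S)"
    by (intro Lim_cong_within) auto
  then show ?thesis
    unfolding has_vector_derivative_def has_derivative_iff_norm
    by (simp add: bounded_linear_scaleR_left tendsto_norm_zero_iff LIM_zero_iff)
qed

lemma has_vector_derivative_two_sided_inverse:
  fixes h :: "real \<Rightarrow> 'a::real_normed_algebra_1"
  assumes h: "(h has_vector_derivative h') (at t within S)"
    and k: "\<And>t. two_sided_inverse (h t) (k t)"
  shows "(k has_vector_derivative - (k t * h' * k t)) (at t within S)"
proof -
  have "(h \<longlongrightarrow> h t) (at t within S)"
    using has_vector_derivative_continuous[OF h] by (simp add: continuous_within)
  then have "(k \<longlongrightarrow> k t) (at t within S)"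
    by (rule tendsto_two_sided_inverse) (rule k)+
  moreover have "((\<lambda>y. (h y - h t) /\<^sub>R (y - t)) \<longlongrightarrow> h') (at t within S)"
    using h by (simp add: has_vector_derivative_iff_quotient)
  ultimately have "((\<lambda>y. - (k y * ((h y - h t) /\<^sub>R (y - t)) * k t)) \<longlongrightarrow> - (k t * h' * k t)) (at t within S)"
    by (intro tendsto_intros)
  moreover have "- (k y * ((h y - h t) /\<^sub>R (y - t)) * k t) = (k y - k t) /\<^sub>R (y - t)" for y
  proof -
    have "k y * (h y - h t) * k t = (k y * h y) * k t - k y * (h t * k t)"
      by (simp add: algebra_simps)
    also have "\<dots> = k t - k y" using k by (simp add: two_sided_inverse_def)
    finally show ?thesis by (simp flip: scaleR_minus_right)
  qed
  ultimately show ?thesis by (simp add: has_vector_derivative_iff_quotient)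
qed

lemma continuous_on_resolvent:
  fixes a :: "'a::complex_unital_banach_algebra" and G :: "complex \<Rightarrow> 'a"
  assumes G: "\<And>z. two_sided_inverse (z *\<^sub>C 1 - a) (G z)"
  shows "continuous_on S G"
  unfolding continuous_on_def
proof
  fix z
  have "((\<lambda>z. z *\<^sub>C 1 - a) \<longlongrightarrow> z *\<^sub>C 1 - a) (at z within S)"
    by (intro tendsto_diff tendsto_const
        bounded_linear.tendsto[OF bounded_linear_scaleC_left tendsto_ident_at])
  then show "(G \<longlongrightarrow> G z) (at z within S)"
    by (rule tendsto_two_sided_inverse) (rule G)+
qed

text \<open>
  The mean value property, obtained by differentiating the circle integral with respect to the
  radius: by the chain rule the derivative of \<open>G (r cis \<theta>)\<close> in \<open>\<theta>\<close> is \<open>\<i> r\<close> times its derivative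
  in \<open>r\<close>, and the integral of the angular derivative over a full period vanishes.
\<close>

lemma circle_mean_resolvent_constant:
  fixes a :: "'a::complex_unital_banach_algebra" and G :: "complex \<Rightarrow> 'a"
  assumes G: "\<And>z. two_sided_inverse (z *\<^sub>C 1 - a) (G z)"
  assumes "r \<ge> 0"
  shows "integral {0..2*pi} (\<lambda>\<theta>. G (complex_of_real r * cis \<theta>)) = (2 * pi) *\<^sub>R G 0"
proof -
  let ?\<phi> = "\<lambda>r. integral (cbox 0 (2*pi)) (\<lambda>\<theta>. G (complex_of_real r * cis \<theta>))"
  define D where "D r \<theta> = - (cis \<theta> *\<^sub>C (G (complex_of_real r * cis \<theta>) * G (complex_of_real r * cis \<theta>)))"
    for r \<theta>
  have contG: "continuous_on UNIV G"
    by (rule continuous_on_resolvent[OF G])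
  note contG' [continuous_intros] = continuous_on_compose2[OF contG _ subset_UNIV]
  note [continuous_intros] = bounded_bilinear.continuous_on[OF bounded_bilinear_scaleC]
  have deriv: "((\<lambda>t. G (\<gamma> t)) has_vector_derivative - (\<gamma>' *\<^sub>C (G (\<gamma> t) * G (\<gamma> t)))) (at t within S)"
    if "(\<gamma> has_vector_derivative \<gamma>') (at t within S)" for \<gamma> \<gamma>' t S
  proof -
    have "((\<lambda>t. \<gamma> t *\<^sub>C 1 - a) has_vector_derivative (\<gamma>' *\<^sub>C 1 - 0)) (at t within S)"
      by (intro has_vector_derivative_diff has_vector_derivative_const
          bounded_linear.has_vector_derivative[OF bounded_linear_scaleC_left that])
    from has_vector_derivative_two_sided_inverse[OF this G]
    show ?thesis by (simp add: mult_scaleC_left mult_scaleC_right)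
  qed
  have cis': "(cis has_vector_derivative \<i> * cis \<theta>) (at \<theta> within S)" for \<theta> S
  proof -
    have "((\<lambda>z. exp (\<i> * z)) has_field_derivative \<i> * cis \<theta>) (at (complex_of_real \<theta>))"
      by (auto simp: cis_conv_exp intro!: derivative_eq_intros)
    from has_vector_derivative_real_field[OF this, of S] show ?thesis
      by (simp flip: cis_conv_exp)
  qed
  have \<phi>': "(?\<phi> has_vector_derivative integral (cbox 0 (2*pi)) (D r)) (at r within {0..})"
    if "r \<ge> 0" for r
  proof (rule leibniz_rule_vector_derivative)
    fix r \<theta> :: real
    have "((\<lambda>r. complex_of_real r * cis \<theta>) has_vector_derivative (1 * cis \<theta>)) (at r within {0..})"
      by (intro has_vector_derivative_mult_left) (auto intro!: derivative_eq_intros)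
    from deriv[OF this]
    show "((\<lambda>r. G (complex_of_real r * cis \<theta>)) has_vector_derivative D r \<theta>) (at r within {0..})"
      by (simp add: D_def)
  next
    fix r :: real
    show "(\<lambda>\<theta>. G (complex_of_real r * cis \<theta>)) integrable_on cbox 0 (2*pi)"
      by (intro integrable_continuous continuous_intros)
  next
    show "continuous_on ({0..} \<times> cbox 0 (2*pi)) (\<lambda>(r, \<theta>). D r \<theta>)"
      unfolding D_def split_beta by (intro continuous_intros)
  qed (use that in auto)
  have D0: "integral (cbox 0 (2*pi)) (D r) = 0" if "r > 0" for r
  proof -
    let ?c = "complex_of_real r * \<i>"
    have "((\<lambda>\<theta>. ?c *\<^sub>C D r \<theta>) has_integral
        G (complex_of_real r * cis (2*pi)) - G (complex_of_real r * cis 0)) {0..2*pi}"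
    proof (rule fundamental_theorem_of_calculus)
      fix \<theta> :: real
      have "((\<lambda>\<theta>. complex_of_real r * cis \<theta>) has_vector_derivative complex_of_real r * (\<i> * cis \<theta>))
          (at \<theta> within {0..2*pi})"
        by (intro has_vector_derivative_mult_right cis')
      from deriv[OF this]
      show "((\<lambda>\<theta>. G (complex_of_real r * cis \<theta>)) has_vector_derivative ?c *\<^sub>C D r \<theta>)
          (at \<theta> within {0..2*pi})"
        by (simp add: D_def scaleC_scaleC mult.assoc
            linear_neg[OF bounded_linear.linear[OF bounded_linear_scaleC_right]])
    qed simp
    then have *: "((\<lambda>\<theta>. ?c *\<^sub>C D r \<theta>) has_integral 0) {0..2*pi}" by simp
    have "(D r has_integral inverse ?c *\<^sub>C 0) {0..2*pi}"
    proof -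
      have "inverse ?c * ?c = 1" using that by (intro left_inverse) simp
      then have "inverse ?c *\<^sub>C (?c *\<^sub>C u) = u" for u :: 'a
        by (simp only: scaleC_scaleC scaleC_one)
      then show ?thesis
        using has_integral_linear[OF * bounded_linear_scaleC_right[of "inverse ?c"]]
        by (simp only: o_def)
    qed
    then show ?thesis
      using linear_0[OF bounded_linear.linear[OF bounded_linear_scaleC_right[of "inverse ?c"]]]
      by (simp add: integral_unique)
  qed
  \<comment> \<open>The factor \<open>\<i> r\<close> cannot be cancelled at radius zero, where continuity suffices.\<close>
  have "?\<phi> r = ?\<phi> 0"
  proof (rule has_derivative_zero_unique_strong_interval[of "{0}" 0 r])
    show "continuous_on {0..r} ?\<phi>"
    proof (rule continuous_on_subset[of "{0..}"])
      show "continuous_on {0..} ?\<phi>"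
        unfolding continuous_on_eq_continuous_within
        using \<phi>' has_vector_derivative_continuous by fastforce
    qed auto
    show "(?\<phi> has_derivative (\<lambda>h. 0)) (at x within {0..r})" if "x \<in> {0..r} - {0}" for x
      using has_derivative_subset[of ?\<phi> _ x "{0..}" "{0..r}"] \<phi>'[of x] D0[of x] that
      by (auto simp: has_vector_derivative_def)
  qed (use \<open>r \<ge> 0\<close> in auto)
  then show ?thesis by simp
qed

text \<open>
  If the resolvent \<open>G\<close> existed everywhere, its value \<open>G 0\<close> would be its mean over arbitrarily
  large circles. There \<open>z G z = 1 + a G z\<close> forces \<open>\<parallel>G z\<parallel> \<le> 1 / (\<bar>z\<bar> - \<parallel>a\<parallel>)\<close>, so \<open>G 0 = 0\<close>, which is
  impossible for an inverse.
\<close>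

lemma spectrum_nonempty:
  fixes a :: "'a::complex_unital_banach_algebra"
  shows "spectrum a \<noteq> {}"
proof
  assume "spectrum a = {}"
  then have "invertible_elem (z *\<^sub>C 1 - a)" for z by (auto simp: spectrum_def)
  then obtain G where G: "\<And>z. two_sided_inverse (z *\<^sub>C 1 - a) (G z)"
    unfolding invertible_elem_def by metis
  \<comment> \<open>With this radius the resolvent on the circle is at most half as large as at its centre.\<close>
  define r where "r = norm a + 2 / norm (G 0)"
  have G0: "norm (G 0) > 0"
    using G[of 0] by (auto simp: two_sided_inverse_def)
  then have r: "r > norm a" "r \<ge> 0" by (simp_all add: r_def add_nonneg_nonneg)
  have bound: "norm (G z) \<le> norm (G 0) / 2" if "cmod z = r" for z
  proof -
    have "z *\<^sub>C G z = 1 + a * G z"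
      using G[of z] by (simp add: two_sided_inverse_def left_diff_distrib mult_scaleC_left algebra_simps)
    then have "cmod z * norm (G z) = norm (1 + a * G z)" by (simp flip: norm_scaleC)
    then have "r * norm (G z) \<le> 1 + norm a * norm (G z)"
      using norm_triangle_ineq[of 1 "a * G z"] norm_mult_ineq[of a "G z"] that
      by simp
    then have "(2 / norm (G 0)) * norm (G z) \<le> 1" by (simp add: r_def algebra_simps)
    then show ?thesis using G0 by (simp add: field_simps)
  qed
  have cont: "continuous_on {0..2*pi} (\<lambda>\<theta>. G (complex_of_real r * cis \<theta>))"
    by (intro continuous_on_compose2[OF continuous_on_resolvent[OF G, of UNIV] _ subset_UNIV]
        continuous_intros)
  have "norm (integral {0..2*pi} (\<lambda>\<theta>. G (complex_of_real r * cis \<theta>))) \<le> norm (G 0) / 2 * (2 * pi - 0)"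
    by (intro integral_bound cont bound) (use r in \<open>auto simp: norm_mult\<close>)
  then have "2 * pi * norm (G 0) \<le> pi * norm (G 0)"
    unfolding circle_mean_resolvent_constant[OF G r(2)] by simp
  then show False using G0 by simp
qed

section \<open>Quasinilpotent elements\<close>

text \<open>
  Nonemptiness of the spectrum enters from right to left: the supremum that defines the spectral
  radius is zero because the spectrum is \<open>{0}\<close> and not empty.
\<close>

lemma qnil_iff:
  "a \<in> qnil \<longleftrightarrow> (\<forall>z. z \<noteq> 0 \<longrightarrow> invertible_elem (z *\<^sub>C 1 - a))"
proof
  assume "a \<in> qnil"
  then have rad: "(SUP z\<in>spectrum a. cmod z) = 0"
    by (simp add: qnil_def spectral_radius_def)
  have "bdd_above (cmod ` spectrum a)"
    by (intro bdd_aboveI2[of _ _ "norm a"] spectrum_norm_le)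
  then have "cmod z \<le> 0" if "z \<in> spectrum a" for z
    using cSUP_upper[OF that, of cmod] unfolding rad by blast
  then show "\<forall>z. z \<noteq> 0 \<longrightarrow> invertible_elem (z *\<^sub>C 1 - a)"
    by (auto simp: spectrum_def)
next
  assume "\<forall>z. z \<noteq> 0 \<longrightarrow> invertible_elem (z *\<^sub>C 1 - a)"
  then have "spectrum a \<subseteq> {0}" by (auto simp: spectrum_def)
  then have "spectrum a = {0}" using spectrum_nonempty[of a] by blast
  then show "a \<in> qnil" by (simp add: qnil_def spectral_radius_def)
qed

lemma qnil_minus_iff: "- a \<in> qnil \<longleftrightarrow> a \<in> qnil"
proof -
  have "- a \<in> qnil" if "a \<in> qnil" for a :: 'a
    unfolding qnil_iff
  proof (intro allI impI)
    fix z :: complex assume "z \<noteq> 0"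
    then have i: "invertible_elem ((- z) *\<^sub>C 1 - a)" using that by (simp add: qnil_iff)
    have eq: "z *\<^sub>C 1 - - a = - ((- z) *\<^sub>C 1 - a)" by (simp add: scaleC_minus_left)
    show "invertible_elem (z *\<^sub>C 1 - - a)"
      unfolding eq
      by (rule invertible_elemI[of _ "- inv_elem ((- z) *\<^sub>C 1 - a)"])
         (simp_all only: minus_mult_minus inv_elem_inverse[OF i])
  qed
  from this[of a] this[of "- a"] show ?thesis by auto
qed

text \<open>
  Jacobson's lemma: if \<open>k\<close> inverts \<open>z - u v\<close>, then \<open>(1 + v k u) / z\<close> inverts \<open>z - v u\<close>.
\<close>

lemma qnil_mult_commute:
  assumes "u * v \<in> qnil"
  shows "v * u \<in> qnil"
  unfolding qnil_iff
proof (intro allI impI)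
  fix z :: complex assume z: "z \<noteq> 0"
  let ?h = "z *\<^sub>C 1 - u * v"
  let ?k = "inv_elem ?h"
  let ?j = "inverse z *\<^sub>C (1 + v * ?k * u)"
  have i: "invertible_elem ?h" using assms z by (simp add: qnil_iff)
  have "(z *\<^sub>C 1 - v * u) * (1 + v * ?k * u) = z *\<^sub>C 1 - v * u + v * (?h * ?k) * u"
    by (simp add: algebra_simps mult_scaleC_left mult_scaleC_right)
  then have 1: "(z *\<^sub>C 1 - v * u) * (1 + v * ?k * u) = z *\<^sub>C 1"
    by (simp add: inv_elem_inverse[OF i])
  have "(1 + v * ?k * u) * (z *\<^sub>C 1 - v * u) = z *\<^sub>C 1 - v * u + v * (?k * ?h) * u"
    by (simp add: algebra_simps mult_scaleC_left mult_scaleC_right scaleC_add_right)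
  then have 2: "(1 + v * ?k * u) * (z *\<^sub>C 1 - v * u) = z *\<^sub>C 1"
    by (simp add: inv_elem_inverse[OF i])
  show "invertible_elem (z *\<^sub>C 1 - v * u)"
    by (rule invertible_elemI[of _ ?j])
       (simp_all only: mult_scaleC_left mult_scaleC_right 1 2,
        use z in \<open>simp_all add: scaleC_scaleC scaleC_one\<close>)
qed

section \<open>Left and right generalized Drazin inverses through their idempotents\<close>

text \<open>
  In terms of \<open>p = 1 - x a\<close>, the equation \<open>x\<^sup>2 a = x\<close> is \<open>x p = 0\<close>, the equation
  \<open>a x a = x a\<^sup>2\<close> is \<open>a p = p a\<close>, and \<open>a x a - a\<close> is \<open>- a p\<close>.
\<close>

lemma left_gDrazin_inverse_iff:
  "left_gDrazin_inverse a x \<longleftrightarrow>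
    x * (1 - x * a) = 0 \<and> a * (1 - x * a) = (1 - x * a) * a \<and> (1 - x * a) * a \<in> qnil"
proof -
  have "a * x * a - a = - (a * (1 - x * a))" by (simp add: algebra_simps)
  then have "a * x * a - a \<in> qnil \<longleftrightarrow> a * (1 - x * a) \<in> qnil"
    by (simp add: qnil_minus_iff)
  then show ?thesis
    unfolding left_gDrazin_inverse_def
    by (auto simp: algebra_simps power2_eq_square)
qed

lemma right_gDrazin_inverse_iff:
  "right_gDrazin_inverse a x \<longleftrightarrow>
    (1 - a * x) * x = 0 \<and> a * (1 - a * x) = (1 - a * x) * a \<and> (1 - a * x) * a \<in> qnil"
proof -
  have "a * x * a - a = - ((1 - a * x) * a)" by (simp add: algebra_simps)
  then have "a * x * a - a \<in> qnil \<longleftrightarrow> (1 - a * x) * a \<in> qnil"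
    by (simp add: qnil_minus_iff)
  then show ?thesis
    unfolding right_gDrazin_inverse_def
    by (auto simp: algebra_simps power2_eq_square)
qed

section \<open>Transfer along intertwining elements\<close>

text \<open>
  The symmetric form of the hypotheses, in which \<open>A\<close>, \<open>B\<close>, \<open>e\<close> stand for \<open>a c\<close>, \<open>b d\<close>, \<open>b a c\<close>.
\<close>

locale intertwined =
  fixes A B d e :: "'a::complex_unital_banach_algebra"
  assumes Ad: "A * d = d * B" and Be: "B * e = e * A"
    and de: "d * e = A * A" and ed: "e * d = B * B"
begin

lemma swap: "intertwined B A e d"
  by unfold_locales (rule Be Ad ed de)+

text \<open>
  For an idempotent \<open>p\<close> as in the next lemma, this is the inverse of \<open>A\<^sup>2\<close> in the corner of \<open>p\<close>.
\<close>

definition corner_inverse :: "'a \<Rightarrow> 'a"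
  where "corner_inverse p = p * inv_elem (1 - p * (1 - A) * (1 + A))"

text \<open>
  Invertibility reduces to the case of a single quasinilpotent element: with \<open>t = p (1 - A)\<close> one
  has \<open>t (1 + A) = 2 t - t\<^sup>2\<close>, so the element in question is \<open>(1 - t)\<^sup>2\<close>.
\<close>

lemma corner_inverse:
  assumes idem: "p * p = p" and comm: "A * p = p * A" and qn: "p * (1 - A) \<in> qnil"
  shows "invertible_elem (1 - p * (1 - A) * (1 + A))"
    and "p * corner_inverse p = corner_inverse p"
    and "A * corner_inverse p = corner_inverse p * A"
    and "corner_inverse p * (A * A) = p"
proof -
  let ?h = "1 - p * (1 - A) * (1 + A)"
  let ?t = "p * (1 - A)"
  have idem': "p * (p * u) = p * u" and comm': "A * (p * u) = p * (A * u)" for u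
    using idem comm by (metis mult.assoc)+
  note expand = algebra_simps idem idem' comm comm'
  have "?h = (1 - ?t) * (1 - ?t)"
    by (simp add: expand)
  moreover have "invertible_elem (1 - ?t)"
    using qn unfolding qnil_iff by (metis scaleC_one zero_neq_one)
  ultimately show i: "invertible_elem ?h" by (simp add: invertible_elem_mult)
  have pk: "p * inv_elem ?h = inv_elem ?h * p"
    by (rule inv_elem_commute[OF i]) (simp add: expand)
  have Ak: "A * inv_elem ?h = inv_elem ?h * A"
    by (rule inv_elem_commute[OF i]) (simp add: expand)
  show "p * corner_inverse p = corner_inverse p"
    by (simp add: corner_inverse_def idem')
  show "A * corner_inverse p = corner_inverse p * A"
    by (simp add: corner_inverse_def mult.assoc comm' Ak[unfolded mult.assoc])
  have "p * (A * A) = ?h * p"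
    by (simp add: expand)
  then have "inv_elem ?h * (p * (A * A)) = p"
    by (simp add: inv_elem_inverse(2)[OF i] del: mult.assoc flip: mult.assoc)
  then show "corner_inverse p * (A * A) = p"
    unfolding corner_inverse_def pk by (simp add: mult.assoc)
qed

text \<open>
  The idempotent that belongs to \<open>1 - B\<close>. That \<open>q\<close> is idempotent uses \<open>s (d e) = s A\<^sup>2 = p\<close>, where
  \<open>s\<close> is the corner inverse;
  quasinilpotence is inherited from \<open>p (1 - A)\<close> by moving the factor \<open>e\<close> from the left end of the
  product \<open>q (1 - B)\<close> to its right end.
\<close>

lemma transferred_idempotent:
  fixes p
  defines "q \<equiv> e * corner_inverse p * d"
  assumes idem: "p * p = p" and comm: "A * p = p * A" and qn: "p * (1 - A) \<in> qnil"
  shows "q * q = q" and "B * q = q * B" and "q * (1 - B) \<in> qnil"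
proof -
  note s = corner_inverse[OF idem comm qn]
  let ?s = "corner_inverse p"
  have "q * q = e * (?s * (d * e)) * ?s * d" by (simp add: q_def mult.assoc)
  also have "\<dots> = e * (p * ?s) * d" by (simp add: de s(4) mult.assoc)
  finally show "q * q = q" by (simp add: s(2) q_def)
  have "B * q = e * (A * ?s) * d" by (simp add: q_def Be flip: mult.assoc)
  also have "\<dots> = q * B" by (simp add: s(3) q_def mult.assoc Ad)
  finally show "B * q = q * B" .
  have "(?s * d * (1 - B)) * e = ?s * (d * e) * (1 - A)"
    by (simp add: algebra_simps Be)
  also have "\<dots> = p * (1 - A)" by (simp add: de s(4))
  finally have "(?s * d * (1 - B)) * e \<in> qnil" using qn by simp
  then have "e * (?s * d * (1 - B)) \<in> qnil" by (rule qnil_mult_commute)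
  then show "q * (1 - B) \<in> qnil" by (simp add: q_def mult.assoc)
qed

text \<open>
  The idempotent of the new inverse \<open>y\<close> is the transferred idempotent \<open>q\<close>: in \<open>y (1 - B)\<close> the
  first summand contributes \<open>(1 - q) (1 - B\<^sup>2)\<close>, and the second one,
  \<open>e (1 - p) d = (1 - q) B\<^sup>2\<close>, restores what is missing from \<open>1 - q\<close>. The relation \<open>y q = 0\<close>
  comes from \<open>x p = 0\<close> after writing \<open>d q = p d\<close>.
\<close>

lemma left_gDrazin_inverse_transfer:
  assumes "left_gDrazin_inverse (1 - A) x"
  defines "p \<equiv> 1 - x * (1 - A)"
  shows "invertible_elem (1 - p * (1 - A) * (1 + A))"
    and "left_gDrazin_inverse (1 - B) ((1 - e * corner_inverse p * d) * (1 + B) + e * x * d)"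
proof -
  have xp: "x * p = 0" and comm': "(1 - A) * p = p * (1 - A)" and qn: "p * (1 - A) \<in> qnil"
    using assms(1) unfolding left_gDrazin_inverse_iff p_def by auto
  have comm: "A * p = p * A" using comm' by (simp add: algebra_simps)
  have "p * p = p - x * ((1 - A) * p)" by (simp add: p_def algebra_simps)
  also have "\<dots> = p" unfolding comm' by (simp add: xp flip: mult.assoc)
  finally have idem: "p * p = p" .
  note s = corner_inverse[OF idem comm qn]
  show "invertible_elem (1 - p * (1 - A) * (1 + A))" by (rule s(1))
  let ?s = "corner_inverse p"
  define q where "q = e * ?s * d"
  define y where "y = (1 - q) * (1 + B) + e * x * d"
  note q = transferred_idempotent[OF idem comm qn, folded q_def]
  have q_ed: "q * (e * d) = e * p * d"
    using s(4) by (simp add: q_def de mult.assoc) (simp add: de flip: mult.assoc)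
  have "e * x * d * (1 - B) = e * (x * (1 - A)) * d"
    by (simp add: algebra_simps Ad)
  also have "x * (1 - A) = 1 - p" by (simp add: p_def)
  also have "e * (1 - p) * d = e * d - q * (e * d)" by (simp add: q_ed algebra_simps)
  finally have "y * (1 - B) = 1 - q"
    by (simp add: y_def ed algebra_simps)
  then have p': "1 - y * (1 - B) = q" by simp
  have "e * x * d * q = e * x * (d * e) * ?s * d" by (simp add: q_def mult.assoc)
  also have "\<dots> = e * (x * (A * A * ?s)) * d" by (simp add: de mult.assoc)
  also have "A * A * ?s = p" using s(3,4) by (metis mult.assoc)
  finally have "e * x * d * q = 0" by (simp add: xp)
  moreover have "(1 - q) * (1 + B) * q = 0"
    using q(1) by (simp add: algebra_simps q(2)) (simp flip: mult.assoc)
  ultimately have "y * q = 0" by (simp add: y_def distrib_right)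
  then have "left_gDrazin_inverse (1 - B) y"
    unfolding left_gDrazin_inverse_iff p' using q(2,3) by (simp add: algebra_simps)
  then show "left_gDrazin_inverse (1 - B) ((1 - e * ?s * d) * (1 + B) + e * x * d)"
    by (simp add: y_def q_def)
qed

lemma right_gDrazin_inverse_transfer:
  assumes "right_gDrazin_inverse (1 - A) x"
  defines "p \<equiv> 1 - (1 - A) * x"
  shows "invertible_elem (1 - p * (1 - A) * (1 + A))"
    and "right_gDrazin_inverse (1 - B) ((1 - e * corner_inverse p * d) * (1 + B) + e * x * d)"
proof -
  have px: "p * x = 0" and comm': "(1 - A) * p = p * (1 - A)" and qn: "p * (1 - A) \<in> qnil"
    using assms(1) unfolding right_gDrazin_inverse_iff p_def by auto
  have comm: "A * p = p * A" using comm' by (simp add: algebra_simps)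
  have "p * p = p - (p * (1 - A)) * x" by (simp add: p_def algebra_simps)
  also have "\<dots> = p" unfolding comm'[symmetric] by (simp add: px mult.assoc)
  finally have idem: "p * p = p" .
  note s = corner_inverse[OF idem comm qn]
  show "invertible_elem (1 - p * (1 - A) * (1 + A))" by (rule s(1))
  let ?s = "corner_inverse p"
  define q where "q = e * ?s * d"
  define y where "y = (1 - q) * (1 + B) + e * x * d"
  note q = transferred_idempotent[OF idem comm qn, folded q_def]
  have q_ed: "q * (e * d) = e * p * d"
    using s(4) by (simp add: q_def de mult.assoc) (simp add: de flip: mult.assoc)
  have "(1 - B) * (e * x * d) = e * ((1 - A) * x) * d"
    by (simp add: left_diff_distrib right_diff_distrib Be flip: mult.assoc)
  also have "(1 - A) * x = 1 - p" by (simp add: p_def)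
  also have "e * (1 - p) * d = e * d - q * (e * d)" by (simp add: q_ed algebra_simps)
  finally have "(1 - B) * (e * x * d) = B * B - q * (B * B)" by (simp add: ed)
  moreover have "(1 - B) * ((1 - q) * (1 + B)) = (1 - q) * (1 - B * B)"
    using q(2) by (simp add: algebra_simps) (simp flip: mult.assoc)
  ultimately have "(1 - B) * y = 1 - q"
    by (simp add: y_def distrib_left) (simp add: algebra_simps)
  then have p': "1 - (1 - B) * y = q" by simp
  have "q * (e * x * d) = e * ?s * (d * e) * x * d" by (simp add: q_def mult.assoc)
  also have "\<dots> = e * ((?s * (A * A)) * x) * d" by (simp add: de mult.assoc)
  finally have "q * (e * x * d) = 0" by (simp add: s(4) px)
  moreover have "q * ((1 - q) * (1 + B)) = 0"
    using q(1) by (simp add: right_diff_distrib flip: mult.assoc)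
  ultimately have "q * y = 0" by (simp add: y_def distrib_left)
  then have "right_gDrazin_inverse (1 - B) y"
    unfolding right_gDrazin_inverse_iff p' using q(2,3) by (simp add: algebra_simps)
  then show "right_gDrazin_inverse (1 - B) ((1 - e * ?s * d) * (1 + B) + e * x * d)"
    by (simp add: y_def q_def)
qed

end

theorem theorem3p7:
  fixes a b c d \<alpha> \<beta> :: "'a::complex_unital_banach_algebra"
  assumes "a * c * d = d * b * d"
    and "d * b * a = a * c * a"
    and "\<alpha> = 1 - a * c"
    and "\<beta> = 1 - b * d"
  shows "
    (left_gDrazin_invertible \<alpha> \<longleftrightarrow> left_gDrazin_invertible \<beta>) \<and>
    (\<forall>x p. left_gDrazin_inverse \<alpha> x \<and> p = 1 - x * \<alpha> \<longrightarrow>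
        invertible_elem (1 - p * \<alpha> * (1 + a * c)) \<and>
        left_gDrazin_inverse \<beta>
          ((1 - b * a * c * p * inv_elem (1 - p * \<alpha> * (1 + a * c)) * d) * (1 + b * d)
            + b * a * c * x * d)) \<and>
    (\<forall>y p'. left_gDrazin_inverse \<beta> y \<and> p' = 1 - y * \<beta> \<longrightarrow>
        invertible_elem (1 - p' * \<beta> * (1 + b * d)) \<and>
        left_gDrazin_inverse \<alpha>
          ((1 - d * p' * inv_elem (1 - p' * \<beta> * (1 + b * d)) * b * a * c) * (1 + a * c)
            + d * y * b * a * c)) \<and>
    (right_gDrazin_invertible \<alpha> \<longleftrightarrow> right_gDrazin_invertible \<beta>) \<and>
    (\<forall>x p. right_gDrazin_inverse \<alpha> x \<and> p = 1 - \<alpha> * x \<longrightarrow>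
        invertible_elem (1 - p * \<alpha> * (1 + a * c)) \<and>
        right_gDrazin_inverse \<beta>
          ((1 - b * a * c * p * inv_elem (1 - p * \<alpha> * (1 + a * c)) * d) * (1 + b * d)
            + b * a * c * x * d)) \<and>
    (\<forall>y p'. right_gDrazin_inverse \<beta> y \<and> p' = 1 - \<beta> * y \<longrightarrow>
        invertible_elem (1 - p' * \<beta> * (1 + b * d)) \<and>
        right_gDrazin_inverse \<alpha>
          ((1 - d * p' * inv_elem (1 - p' * \<beta> * (1 + b * d)) * b * a * c) * (1 + a * c)
            + d * y * b * a * c))"
proof -
  interpret I: intertwined "a * c" "b * d" d "b * a * c"
  proof
    show "a * c * d = d * (b * d)" using assms(1) by (simp add: mult.assoc)
    show "b * d * (b * a * c) = b * a * c * (a * c)" using assms(2) by (metis mult.assoc)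
    show "d * (b * a * c) = a * c * (a * c)" using assms(2) by (metis mult.assoc)
    show "b * a * c * d = b * d * (b * d)" using assms(1) by (metis mult.assoc)
  qed
  interpret J: intertwined "b * d" "a * c" "b * a * c" d
    by (rule I.swap)
  have L1: "invertible_elem (1 - p * \<alpha> * (1 + a * c)) \<and>
      left_gDrazin_inverse \<beta>
        ((1 - b * a * c * p * inv_elem (1 - p * \<alpha> * (1 + a * c)) * d) * (1 + b * d) + b * a * c * x * d)"
    if "left_gDrazin_inverse \<alpha> x \<and> p = 1 - x * \<alpha>" for x p
    using that I.left_gDrazin_inverse_transfer[of x]
    by (simp add: assms(3,4) I.corner_inverse_def mult.assoc)
  have L2: "invertible_elem (1 - p' * \<beta> * (1 + b * d)) \<and>
      left_gDrazin_inverse \<alpha>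
        ((1 - d * p' * inv_elem (1 - p' * \<beta> * (1 + b * d)) * b * a * c) * (1 + a * c) + d * y * b * a * c)"
    if "left_gDrazin_inverse \<beta> y \<and> p' = 1 - y * \<beta>" for y p'
    using that J.left_gDrazin_inverse_transfer[of y]
    by (simp add: assms(3,4) J.corner_inverse_def mult.assoc)
  have R1: "invertible_elem (1 - p * \<alpha> * (1 + a * c)) \<and>
      right_gDrazin_inverse \<beta>
        ((1 - b * a * c * p * inv_elem (1 - p * \<alpha> * (1 + a * c)) * d) * (1 + b * d) + b * a * c * x * d)"
    if "right_gDrazin_inverse \<alpha> x \<and> p = 1 - \<alpha> * x" for x p
    using that I.right_gDrazin_inverse_transfer[of x]
    by (simp add: assms(3,4) I.corner_inverse_def mult.assoc)
  have R2: "invertible_elem (1 - p' * \<beta> * (1 + b * d)) \<and>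
      right_gDrazin_inverse \<alpha>
        ((1 - d * p' * inv_elem (1 - p' * \<beta> * (1 + b * d)) * b * a * c) * (1 + a * c) + d * y * b * a * c)"
    if "right_gDrazin_inverse \<beta> y \<and> p' = 1 - \<beta> * y" for y p'
    using that J.right_gDrazin_inverse_transfer[of y]
    by (simp add: assms(3,4) J.corner_inverse_def mult.assoc)
  show ?thesis
    unfolding left_gDrazin_invertible_def right_gDrazin_invertible_def
    using L1 L2 R1 R2 by blast
qed

end
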